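(* Let $S$ be a finite set and let $f$ be a permutation of $S$. Let $\mathbf{Z}_i=\{Z_{i,1},\dots,Z_{i,n_i}\}$ be the set of $f$-cycles of length $i$ and let $\mathbf{Z}=\bigsqcup_i\mathbf{Z}_i$. For every $f$-cycle $Z_{i,j}$ choose an element $x_{i,j}\in\mathcal{V}(Z_{i,j})$, and let $X$ be the set of all the chosen elements $x_{i,j}$. Then every permutation $g$ of $S$ with $fg=gf$ is bijectively determined by the pair $[\widetilde g, g|_X]$, where $\widetilde g$ is the map induced by $g$ on $f$-cycles. That is, $g\mapsto[\widetilde g,g|_X]$ is a bijection from $\mathcal{C}_{bij}(f)$ onto the set of pairs $[\pi,h]$ such that: (1) $\pi$ is a permutation of $\mathbf{Z}$ with $\pi(\mathbf{Z}_i)=\mathbf{Z}_i$ for every $i$; (2) $h:X\to S$ is a function with $h(x_{i,j})\in\mathcal{V}(\pi(Z_{i,j}))$ for all $i,j$.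
   Context: For $f:S\to S$, the functional graph $\Gamma(f)$ is the directed graph with vertex set $S$ and edges $[s,f(s)]$, $s\in S$. For a permutation $f$ of a finite set, the $f$-cycles are the directed cycles of $\Gamma(f)$ (including fixed points, regarded as cycles of length $1$); $\mathcal{V}(Z)$ is the vertex set of $Z$. $\mathcal{C}_{bij}(f)$ is the set of permutations $g$ of $S$ with $fg=gf$. Such a $g$ maps each $f$-cycle onto an $f$-cycle of the same length, and $\widetilde g(Z)$ denotes the $f$-cycle with vertex set $g(\mathcal{V}(Z))$. *)

theory Defs
  imports
    "Graph_Theory.Pair_Digraph"
    "HOL-Combinatorics.Permutations"
    "HOL-Library.FuncSet"
begin

definition functional_graph :: "'a set \<Rightarrow> ('a \<Rightarrow> 'a) \<Rightarrow> 'a pair_pre_digraph" where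
  "functional_graph S f = \<lparr>pverts = S, parcs = {(s, f s) | s. s \<in> S}\<rparr>"

text \<open>
  The library's cycles are lists of arcs, so the rotations of a cycle are distinct lists.
  A cycle as a mathematical object is taken to be the subgraph such a list traverses. Loops are
  cycles of length 1.
\<close>

definition traversed_subgraph :: "('a \<times> 'a) awalk \<Rightarrow> 'a pair_pre_digraph" where
  "traversed_subgraph p = \<lparr>pverts = fst ` set p, parcs = set p\<rparr>"

definition f_cycles_of_length ::
    "'a set \<Rightarrow> ('a \<Rightarrow> 'a) \<Rightarrow> nat \<Rightarrow> 'a pair_pre_digraph set" where
  "f_cycles_of_length S f i =
     {traversed_subgraph p | p.
        pre_digraph.cycle (with_proj (functional_graph S f)) p \<and> length p = i}"

definition f_cycles :: "'a set \<Rightarrow> ('a \<Rightarrow> 'a) \<Rightarrow> 'a pair_pre_digraph set" where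
  "f_cycles S f = (\<Union>i. f_cycles_of_length S f i)"

definition commuting_permutations :: "'a set \<Rightarrow> ('a \<Rightarrow> 'a) \<Rightarrow> ('a \<Rightarrow> 'a) set" where
  "commuting_permutations S f = {g. g permutes S \<and> f \<circ> g = g \<circ> f}"

text \<open>
  The value outside \<open>f_cycles S f\<close> follows the convention of \<^const>\<open>permutes\<close>: permutations of a
  set are extended by the identity. The description is meaningful because an arc of a functional
  graph is determined by its source, so a cycle is determined by its vertex set.
\<close>

definition induced_cycle_map ::
    "'a set \<Rightarrow> ('a \<Rightarrow> 'a) \<Rightarrow> ('a \<Rightarrow> 'a) \<Rightarrow> 'a pair_pre_digraph \<Rightarrow> 'a pair_pre_digraph" where
  "induced_cycle_map S f g Z =
     (if Z \<in> f_cycles S f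
      then THE W. W \<in> f_cycles S f \<and> pverts W = g ` pverts Z
      else Z)"

end

theory Submission
  imports Defs "HOL-Combinatorics.Orbits" "HOL-Combinatorics.Cycles"
begin

text \<open>
  Write \<open>a\<close> for the representative \<open>x Z\<close> of a cycle \<open>Z\<close>. Every point of \<open>Z\<close> has the form
  \<open>(f ^^ n) a\<close>, and a permutation \<open>g\<close> that commutes with \<open>f\<close> must send it to \<open>(f ^^ n) (g a)\<close>. Hence
  \<open>g\<close> is determined by its values at the representatives
  (\<open>commuting_permutations_eqI\<close>); the map on cycles is in turn the one that sends
  the cycle of \<open>a\<close> to the cycle of \<open>g a\<close>.

  Conversely, given \<open>\<pi>\<close> and \<open>h\<close>, the formula \<open>(f ^^ n) a \<mapsto> (f ^^ n) (h a)\<close> is the only candidate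
  for \<open>g\<close>. The exponent \<open>n\<close> is determined only modulo the length of the cycle through \<open>a\<close>, and \<open>h a\<close>
  lies on \<open>\<pi> Z\<close>, which has the same length because \<open>\<pi>\<close> preserves lengths; so the formula is
  independent of the choice of \<open>n\<close> (\<open>funpow_eq_transfer\<close>). The resulting \<open>g\<close> commutes with \<open>f\<close>
  because \<open>n\<close> and \<open>Suc n\<close> may both be used as exponents, and it is onto because \<open>\<pi>\<close> reaches every
  cycle (\<open>commuting_permutation_extension\<close>). Finiteness of \<open>S\<close> then makes it a bijection.

  To speak of cycles in these terms one has to identify the graph-theoretic cycles with the
  orbits of \<open>f\<close>: each vertex has a single outgoing arc, so a walk is determined by its start
  and its length, and it is a cycle exactly when its length is the size of the orbit of its
  start (\<open>cycle_functional_graph_iff\<close>).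
\<close>

section \<open>Orbits and periods\<close>

lemma card_orbit_eq_least_power:
  assumes "permutation f"
  shows "card (orbit f s) = least_power f s"
proof -
  have "orbit f s = set (support f s)"
    unfolding support_set[OF assms] orbit_altdef_permutation[OF assms] by auto
  then have "card (orbit f s) = length (support f s)"
    using cycle_of_permutation[OF assms, of s] by (metis distinct_card)
  then show ?thesis by simp
qed

lemma funpow_eq_self_iff_card_orbit_dvd:
  assumes "permutation f"
  shows "(f ^^ n) s = s \<longleftrightarrow> card (orbit f s) dvd n"
  using assms by (simp add: card_orbit_eq_least_power least_power_dvd)

text \<open>
  Both equations say that the orbit size divides the difference of the exponents.
\<close>

lemma funpow_eq_transfer:
  assumes f: "permutation f" and card: "card (orbit f b) = card (orbit f a)"
    and eq: "(f ^^ m) a = (f ^^ n) a"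
  shows "(f ^^ m) b = (f ^^ n) b"
proof -
  have *: "(f ^^ i) b = (f ^^ j) b" if "i \<le> j" "(f ^^ i) a = (f ^^ j) a" for i j
  proof -
    have "inj f" using f by (simp add: permutation bij_is_inj)
    then have "(f ^^ (j - i)) a = a" using that by (rule funpow_diff)
    then have "(f ^^ (j - i)) b = b"
      by (simp add: funpow_eq_self_iff_card_orbit_dvd[OF f] card)
    then show ?thesis
      using that(1) by (metis comp_apply funpow_add le_add_diff_inverse)
  qed
  show ?thesis
    using *[of m n] *[of n m] eq by (metis nat_le_linear)
qed

text \<open>
  Commutation turns \<open>g ((f ^^ n) s)\<close> into \<open>(f ^^ n) (g s)\<close>; this is why \<open>g\<close> induces a map on cycles.
\<close>

lemma image_orbit_commuting:
  assumes "permutation f" and "f \<circ> g = g \<circ> f"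
  shows "g ` orbit f s = orbit f (g s)"
proof (rule orbit_inverse)
  show "s \<in> orbit f s" using assms(1) by (rule permutation_self_in_orbit)
  show "f (g t) = g (f t)" for t using fun_cong[OF assms(2), of t] by simp
qed

lemma funpow_commuting:
  assumes "f \<circ> g = g \<circ> f"
  shows "g ((f ^^ n) s) = (f ^^ n) (g s)"
proof -
  have "g (f t) = f (g t)" for t using fun_cong[OF assms, of t] by simp
  then show ?thesis by (induction n) simp_all
qed

section \<open>Cycles of the functional graph of a permutation\<close>

definition walk_along :: "('a \<Rightarrow> 'a) \<Rightarrow> 'a \<Rightarrow> nat \<Rightarrow> ('a \<times> 'a) list" where
  "walk_along f u n = map (\<lambda>k. ((f ^^ k) u, (f ^^ Suc k) u)) [0..<n]"

lemma length_walk_along [simp]: "length (walk_along f u n) = n"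
  by (simp add: walk_along_def)

lemma walk_along_Suc: "walk_along f u (Suc n) = (u, f u) # walk_along f (f u) n"
  unfolding walk_along_def
  by (simp add: upt_conv_Cons map_Suc_upt[symmetric] funpow_swap1 del: upt_Suc)

lemma pawalk_verts_walk_along:
  "pawalk_verts u (walk_along f u n) = map (\<lambda>k. (f ^^ k) u) [0..<Suc n]"
proof (induction n arbitrary: u)
  case 0
  show ?case by (simp add: walk_along_def)
next
  case (Suc n)
  have "map (\<lambda>k. (f ^^ k) u) [0..<Suc (Suc n)] = u # map (\<lambda>k. (f ^^ k) (f u)) [0..<Suc n]"
    by (simp add: upt_conv_Cons map_Suc_upt[symmetric] funpow_swap1 del: upt_Suc)
  then show ?case using Suc by (simp add: walk_along_Suc)
qed

definition cycle_through :: "('a \<Rightarrow> 'a) \<Rightarrow> 'a \<Rightarrow> 'a pair_pre_digraph" where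
  "cycle_through f s = \<lparr>pverts = orbit f s, parcs = (\<lambda>t. (t, f t)) ` orbit f s\<rparr>"

lemma pverts_cycle_through [simp]: "pverts (cycle_through f s) = orbit f s"
  by (simp add: cycle_through_def)

locale finite_permutation =
  fixes S :: "'a set" and f :: "'a \<Rightarrow> 'a"
  assumes finite: "finite S" and permutes: "f permutes S"
begin

lemma permutation_f: "permutation f"
  using finite permutes permutation_permutes by blast

lemma funpow_in_iff: "(f ^^ n) s \<in> S \<longleftrightarrow> s \<in> S"
  using permutes_funpow[OF permutes] permutes_in_image by metis

lemma in_orbit_self: "s \<in> orbit f s"
  by (rule permutation_self_in_orbit[OF permutation_f])

lemma orbit_eq_iff: "orbit f s = orbit f t \<longleftrightarrow> s \<in> orbit f t"
  using in_orbit_self cyclic_on_orbit'[OF permutation_f] orbit_cyclic_eq3 by metis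

lemma orbit_funpowE:
  assumes "t \<in> orbit f s"
  obtains n where "t = (f ^^ n) s"
  using assms by (auto simp: orbit_altdef)

text \<open>
  Each vertex \<open>s\<close> has exactly one outgoing arc \<open>(s, f s)\<close>, which leaves a walk no choice.
\<close>

lemma awalk_functional_graph_iff:
  "pre_digraph.awalk (with_proj (functional_graph S f)) u p v \<longleftrightarrow>
     u \<in> S \<and> p = walk_along f u (length p) \<and> v = (f ^^ length p) u"
proof -
  have "pcas u p v \<and> set p \<subseteq> {(s, f s) | s. s \<in> S} \<longleftrightarrow>
      p = walk_along f u (length p) \<and> v = (f ^^ length p) u" if "u \<in> S" for u
    using that
  proof (induction p arbitrary: u)
    case Nil
    then show ?case by (auto simp: walk_along_def)
  next
    case (Cons e p)
    have "f u \<in> S" using Cons.prems permutes by (simp add: permutes_in_image)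
    note IH = Cons.IH[OF this]
    show ?case
      using IH Cons.prems by (cases e) (auto simp: walk_along_Suc funpow_swap1)
  qed
  then show ?thesis
    by (auto simp: pre_digraph.awalk_def cas_with_proj_eq functional_graph_def)
qed

lemma traversed_walk_along:
  assumes "(f ^^ n) u = u" and "0 < n"
  shows "traversed_subgraph (walk_along f u n) = cycle_through f u"
proof -
  have "orbit f u = (\<lambda>k. (f ^^ k) u) ` {..<n}"
    using orbit_altdef_bounded[OF assms] by auto
  then show ?thesis
    by (simp add: traversed_subgraph_def cycle_through_def walk_along_def image_image
        atLeast0LessThan)
qed

text \<open>
  The walk of length \<open>n\<close> from \<open>u\<close> is closed exactly when \<open>n\<close> is a multiple of the orbit size, and
  does not repeat a vertex before its end exactly when \<open>n\<close> does not exceed the orbit size.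
\<close>

lemma cycle_functional_graph_iff:
  "pre_digraph.cycle (with_proj (functional_graph S f)) p \<longleftrightarrow>
     (\<exists>u\<in>S. p = walk_along f u (card (orbit f u)))"
proof -
  \<comment> \<open>Past its first entry, the vertex list of a cycle is distinct; this part lists the first
    \<open>n\<close> iterates of \<open>f u\<close>, so facts about periods are applied at \<open>f u\<close>, whose orbit is that of \<open>u\<close>.\<close>
  have shift: "tl (map (\<lambda>k. (f ^^ k) u) [0..<Suc n]) = map (\<lambda>k. (f ^^ k) (f u)) [0..<n]" for u n
    by (simp add: upt_conv_Cons map_Suc_upt[symmetric] funpow_swap1 del: upt_Suc)
  have closed: "(f ^^ n) (f u) = f u" if "(f ^^ n) u = u" for n u
    using that by (metis funpow_swap1)
  have orbit_f: "orbit f (f u) = orbit f u" for u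
    by (rule permutation_orbit_step[OF permutation_f])
  have "(f ^^ n) u = u \<and> distinct (map (\<lambda>k. (f ^^ k) (f u)) [0..<n]) \<and> 0 < n
      \<longleftrightarrow> n = card (orbit f u)" for u n
  proof (intro iffI conjI; (elim conjE)?)
    assume n: "(f ^^ n) u = u" "distinct (map (\<lambda>k. (f ^^ k) (f u)) [0..<n])" "0 < n"
    have "orbit f u = set (map (\<lambda>k. (f ^^ k) (f u)) [0..<n])"
      using orbit_altdef_bounded[OF closed[OF n(1)] n(3)] orbit_f by auto
    then show "n = card (orbit f u)"
      using distinct_card[OF n(2)] by simp
  next
    assume n: "n = card (orbit f u)"
    show "(f ^^ n) u = u"
      by (simp add: n funpow_eq_self_iff_card_orbit_dvd[OF permutation_f])
    have "n = least_power f (f u)"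
      using card_orbit_eq_least_power[OF permutation_f, of "f u"] n orbit_f by simp
    then show "distinct (map (\<lambda>k. (f ^^ k) (f u)) [0..<n])"
      using cycle_of_permutation[OF permutation_f, of "f u"] by simp
    show "0 < n"
      using n card_orbit_eq_least_power[OF permutation_f] least_power_of_permutation(2)[OF permutation_f]
      by simp
  qed
  note period = this
  show ?thesis
  proof
    assume "pre_digraph.cycle (with_proj (functional_graph S f)) p"
    then obtain u where u: "u \<in> S" "p = walk_along f u (length p)" "u = (f ^^ length p) u"
      "distinct (tl (pawalk_verts u p))" "p \<noteq> []"
      unfolding pre_digraph.cycle_def awalk_functional_graph_iff awalk_verts_with_proj_eq by blast
    have "distinct (map (\<lambda>k. (f ^^ k) (f u)) [0..<length p])"
      using u(2,4) pawalk_verts_walk_along[of u f "length p"] shift[of u "length p"] by metis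
    then have "length p = card (orbit f u)"
      using u(3,5) period[of "length p" u] by simp
    then show "\<exists>u\<in>S. p = walk_along f u (card (orbit f u))"
      using u by auto
  next
    assume "\<exists>u\<in>S. p = walk_along f u (card (orbit f u))"
    then obtain u n where u: "u \<in> S" "p = walk_along f u n" "n = card (orbit f u)" by blast
    have "(f ^^ n) u = u" "distinct (map (\<lambda>k. (f ^^ k) (f u)) [0..<n])" "0 < n"
      using period[of n u] u(3) by auto
    then have "u = (f ^^ length p) u" "distinct (tl (pawalk_verts u p))" "p \<noteq> []"
      unfolding u(2) pawalk_verts_walk_along shift by (auto simp: walk_along_def)
    moreover have "p = walk_along f u (length p)" using u(2) by simp
    ultimately show "pre_digraph.cycle (with_proj (functional_graph S f)) p"
      unfolding pre_digraph.cycle_def awalk_functional_graph_iff awalk_verts_with_proj_eq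
      using u(1) by blast
  qed
qed

text \<open>
  Rotations of a cyclic walk traverse the same subgraph, so orbits give each cycle once.
\<close>

lemma f_cycles_of_length_eq:
  "f_cycles_of_length S f i = cycle_through f ` {s \<in> S. card (orbit f s) = i}"
proof -
  have "traversed_subgraph (walk_along f u (card (orbit f u))) = cycle_through f u" for u
  proof (rule traversed_walk_along)
    show "(f ^^ card (orbit f u)) u = u"
      by (simp add: funpow_eq_self_iff_card_orbit_dvd[OF permutation_f])
    show "0 < card (orbit f u)"
      using finite_orbit[OF in_orbit_self] orbit_nonempty by (metis card_gt_0_iff)
  qed
  then have traversed: "traversed_subgraph p = cycle_through f u \<and> length p = card (orbit f u)"
    if "p = walk_along f u (card (orbit f u))" for p u
    using that by simp
  show ?thesis
    unfolding f_cycles_of_length_def cycle_functional_graph_iff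
  proof (intro equalityI subsetI)
    fix C
    assume "C \<in> {traversed_subgraph p | p.
      (\<exists>u\<in>S. p = walk_along f u (card (orbit f u))) \<and> length p = i}"
    then obtain p u where "u \<in> S" "p = walk_along f u (card (orbit f u))" "length p = i"
      "C = traversed_subgraph p" by blast
    then show "C \<in> cycle_through f ` {s \<in> S. card (orbit f s) = i}"
      using traversed by auto
  next
    fix C
    assume "C \<in> cycle_through f ` {s \<in> S. card (orbit f s) = i}"
    then obtain u where "u \<in> S" "card (orbit f u) = i" "C = cycle_through f u" by blast
    then have "C = traversed_subgraph (walk_along f u (card (orbit f u)))"
      "length (walk_along f u (card (orbit f u))) = i"
      using traversed[OF refl, of u] by metis+
    then show "C \<in> {traversed_subgraph p | p.
      (\<exists>u\<in>S. p = walk_along f u (card (orbit f u))) \<and> length p = i}"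
      using \<open>u \<in> S\<close> by blast
  qed
qed

lemma f_cycles_eq: "f_cycles S f = cycle_through f ` S"
  by (auto simp: f_cycles_def f_cycles_of_length_eq)

lemma f_cycles_of_length_conv: "f_cycles_of_length S f i = {Z \<in> f_cycles S f. card (pverts Z) = i}"
  by (auto simp: f_cycles_eq f_cycles_of_length_eq)

lemma cycle_through_mem: "s \<in> S \<Longrightarrow> cycle_through f s \<in> f_cycles S f"
  by (simp add: f_cycles_eq)

lemma f_cycle_eq_cycle_through:
  assumes "Z \<in> f_cycles S f" and "s \<in> pverts Z"
  shows "Z = cycle_through f s"
  using assms by (auto simp: f_cycles_eq cycle_through_def orbit_eq_iff[symmetric])

lemma pverts_f_cycle_subset:
  assumes "Z \<in> f_cycles S f"
  shows "pverts Z \<subseteq> S"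
proof -
  obtain s where "s \<in> S" "Z = cycle_through f s" using assms unfolding f_cycles_eq by blast
  then show ?thesis by (simp add: permutes_orbit_subset[OF permutes])
qed

section \<open>The map induced on cycles\<close>

text \<open>
  The definite description in \<^const>\<open>induced_cycle_map\<close> is resolved by the fact that a cycle is
  determined by any of its vertices.
\<close>

lemma induced_cycle_map_cycle_through:
  assumes g: "g \<in> commuting_permutations S f" and s: "s \<in> S"
  shows "induced_cycle_map S f g (cycle_through f s) = cycle_through f (g s)"
proof -
  have img: "g ` orbit f s = orbit f (g s)" and gs: "g s \<in> S"
    using g s image_orbit_commuting[OF permutation_f]
    by (auto simp: commuting_permutations_def permutes_in_image)
  have "(THE W. W \<in> f_cycles S f \<and> pverts W = g ` pverts (cycle_through f s))
      = cycle_through f (g s)"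
  proof (rule the_equality)
    show "cycle_through f (g s) \<in> f_cycles S f \<and>
        pverts (cycle_through f (g s)) = g ` pverts (cycle_through f s)"
      using gs img by (simp add: cycle_through_mem)
  next
    fix W assume W: "W \<in> f_cycles S f \<and> pverts W = g ` pverts (cycle_through f s)"
    then have "g s \<in> pverts W" using in_orbit_self[of s] by auto
    then show "W = cycle_through f (g s)" using W f_cycle_eq_cycle_through by blast
  qed
  then show ?thesis
    using s by (simp add: induced_cycle_map_def cycle_through_mem)
qed

lemma pverts_induced_cycle_map:
  assumes "g \<in> commuting_permutations S f" and "Z \<in> f_cycles S f"
  shows "pverts (induced_cycle_map S f g Z) = g ` pverts Z"
proof -
  obtain s where s: "s \<in> S" "Z = cycle_through f s"
    using assms(2) unfolding f_cycles_eq by blast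
  have "f \<circ> g = g \<circ> f"
    using assms(1) unfolding commuting_permutations_def by blast
  then have "g ` orbit f s = orbit f (g s)"
    by (rule image_orbit_commuting[OF permutation_f])
  then show ?thesis
    unfolding s(2) induced_cycle_map_cycle_through[OF assms(1) s(1)] pverts_cycle_through ..
qed

text \<open>
  Surjectivity is inherited from \<open>g\<close>, because the cycle through \<open>s\<close> goes to the cycle through
  \<open>g s\<close>; injectivity follows since there are finitely many cycles.
\<close>

lemma induced_cycle_map_permutes:
  assumes g: "g \<in> commuting_permutations S f"
  shows "induced_cycle_map S f g permutes f_cycles S f"
proof (rule bij_imp_permutes)
  have gS: "g permutes S" using g by (simp add: commuting_permutations_def)
  have "induced_cycle_map S f g ` f_cycles S f = cycle_through f ` g ` S"
    using g by (auto simp: f_cycles_eq image_image induced_cycle_map_cycle_through)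
  then have "induced_cycle_map S f g ` f_cycles S f = f_cycles S f"
    by (simp add: permutes_image[OF gS] f_cycles_eq)
  moreover have "finite (f_cycles S f)" using finite by (simp add: f_cycles_eq)
  ultimately show "bij_betw (induced_cycle_map S f g) (f_cycles S f) (f_cycles S f)"
    by (simp add: bij_betw_def eq_card_imp_inj_on)
qed (simp add: induced_cycle_map_def)

lemma induced_cycle_map_image_length:
  assumes g: "g \<in> commuting_permutations S f"
  shows "induced_cycle_map S f g ` f_cycles_of_length S f i = f_cycles_of_length S f i"
proof -
  let ?\<pi> = "induced_cycle_map S f g"
  have "inj g" using g by (auto simp: commuting_permutations_def permutes_inj)
  then have card: "card (pverts (?\<pi> Z)) = card (pverts Z)" if "Z \<in> f_cycles S f" for Z
    by (simp add: pverts_induced_cycle_map[OF g that] card_image inj_on_subset)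
  have "?\<pi> ` f_cycles_of_length S f i = ?\<pi> ` {Z \<in> f_cycles S f. card (pverts (?\<pi> Z)) = i}"
    unfolding f_cycles_of_length_conv using card by (intro arg_cong[where f = "(`) ?\<pi>"]) auto
  also have "\<dots> = {W \<in> ?\<pi> ` f_cycles S f. card (pverts W) = i}"
    by blast
  also have "\<dots> = f_cycles_of_length S f i"
    unfolding f_cycles_of_length_conv permutes_image[OF induced_cycle_map_permutes[OF g]] ..
  finally show ?thesis .
qed

section \<open>Reconstruction from the values at representatives\<close>

text \<open>
  A prescription of values at the representatives that respects cycle lengths extends to a
  commuting permutation, by transporting each value along the iterates of \<open>f\<close>.
\<close>

lemma commuting_permutation_extension:
  assumes x: "\<And>Z. Z \<in> f_cycles S f \<Longrightarrow> x Z \<in> pverts Z"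
    and \<pi>: "\<pi> permutes f_cycles S f"
    and len: "\<And>i. \<pi> ` f_cycles_of_length S f i = f_cycles_of_length S f i"
    and h: "\<And>Z. Z \<in> f_cycles S f \<Longrightarrow> h (x Z) \<in> pverts (\<pi> Z)"
  obtains g where "g \<in> commuting_permutations S f"
    and "\<And>Z. Z \<in> f_cycles S f \<Longrightarrow> g (x Z) = h (x Z)"
proof -
  \<comment> \<open>\<open>funpow_dist\<close> picks the least exponent that leads from the representative to \<open>s\<close>; by
    \<open>g_funpow\<close> below every other exponent gives the same value.\<close>
  define rep where "rep s = x (cycle_through f s)" for s
  define g where "g s = (if s \<in> S then (f ^^ funpow_dist f (rep s) s) (h (rep s)) else s)" for s
  have \<pi>_mem: "\<pi> Z \<in> f_cycles S f" if "Z \<in> f_cycles S f" for Z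
    using that \<pi> by (simp add: permutes_in_image)
  have orbit_x: "orbit f (x Z) = pverts Z" and orbit_h: "orbit f (h (x Z)) = pverts (\<pi> Z)"
    if "Z \<in> f_cycles S f" for Z
    using that f_cycle_eq_cycle_through[OF that x[OF that]]
      f_cycle_eq_cycle_through[OF \<pi>_mem[OF that] h[OF that]] pverts_cycle_through by metis+
  have card_eq: "card (orbit f (h (x Z))) = card (orbit f (x Z))" if "Z \<in> f_cycles S f" for Z
  proof -
    have "Z \<in> f_cycles_of_length S f (card (pverts Z))"
      using that by (simp add: f_cycles_of_length_conv)
    then have "\<pi> Z \<in> f_cycles_of_length S f (card (pverts Z))"
      using len by blast
    then show ?thesis
      by (simp add: f_cycles_of_length_conv orbit_x orbit_h that)
  qed
  have x_S: "x Z \<in> S" and h_S: "h (x Z) \<in> S" if "Z \<in> f_cycles S f" for Z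
    using that x h \<pi>_mem pverts_f_cycle_subset by blast+
  have g_funpow: "g ((f ^^ n) (x Z)) = (f ^^ n) (h (x Z))" if Z: "Z \<in> f_cycles S f" for Z n
  proof -
    let ?s = "(f ^^ n) (x Z)"
    have s: "?s \<in> orbit f (x Z)" by (rule funpow_in_orbit[OF in_orbit_self])
    then have "rep ?s = x Z"
      using f_cycle_eq_cycle_through[OF Z, of ?s] orbit_x[OF Z] by (simp add: rep_def)
    moreover have "?s \<in> S" using x_S[OF Z] by (simp add: funpow_in_iff)
    ultimately have "g ?s = (f ^^ funpow_dist f (x Z) ?s) (h (x Z))"
      by (simp add: g_def)
    also have "\<dots> = (f ^^ n) (h (x Z))"
      using funpow_eq_transfer[OF permutation_f card_eq[OF Z]] funpow_dist_prop[OF s] by blast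
    finally show ?thesis .
  qed
  have decompose: "\<exists>Z\<in>f_cycles S f. \<exists>n. s = (f ^^ n) (x Z)" if "s \<in> S" for s
  proof -
    have "s \<in> orbit f (x (cycle_through f s))"
      using orbit_x[OF cycle_through_mem[OF that]] in_orbit_self by simp
    then show ?thesis
      using cycle_through_mem[OF that] orbit_funpowE by metis
  qed
  have into: "g s \<in> S" if "s \<in> S" for s
    using decompose[OF that] g_funpow h_S by (auto simp: funpow_in_iff)
  have onto: "t \<in> g ` S" if t: "t \<in> S" for t
  proof -
    obtain Z where Z: "Z \<in> f_cycles S f" "\<pi> Z = cycle_through f t"
      using permutes_image[OF \<pi>] cycle_through_mem[OF t] by (metis imageE)
    then have "t \<in> orbit f (h (x Z))"
      using orbit_h in_orbit_self by simp
    then obtain n where "t = (f ^^ n) (h (x Z))" by (rule orbit_funpowE)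
    then have "t = g ((f ^^ n) (x Z))" by (simp add: g_funpow[OF Z(1)])
    then show ?thesis using x_S[OF Z(1)] by (simp add: funpow_in_iff)
  qed
  have "g ` S = S" using into onto by blast
  then have "bij_betw g S S"
    using finite by (simp add: bij_betw_def eq_card_imp_inj_on)
  then have "g permutes S" by (rule bij_imp_permutes) (simp add: g_def)
  moreover have "f (g s) = g (f s)" for s
  proof (cases "s \<in> S")
    case True
    then obtain Z n where "Z \<in> f_cycles S f" "s = (f ^^ n) (x Z)" using decompose by blast
    then show ?thesis using g_funpow[of Z n] g_funpow[of Z "Suc n"] by simp
  next
    case False
    then show ?thesis using permutes by (simp add: g_def permutes_not_in)
  qed
  ultimately have "g \<in> commuting_permutations S f"
    by (simp add: commuting_permutations_def fun_eq_iff)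
  moreover have "g (x Z) = h (x Z)" if "Z \<in> f_cycles S f" for Z
    using g_funpow[OF that, of 0] by simp
  ultimately show thesis by (rule that)
qed

lemma commuting_permutations_eqI:
  assumes x: "\<And>Z. Z \<in> f_cycles S f \<Longrightarrow> x Z \<in> pverts Z"
    and g: "g \<in> commuting_permutations S f" and g': "g' \<in> commuting_permutations S f"
    and eq: "\<And>Z. Z \<in> f_cycles S f \<Longrightarrow> g (x Z) = g' (x Z)"
  shows "g = g'"
proof
  fix s
  show "g s = g' s"
  proof (cases "s \<in> S")
    case True
    let ?Z = "cycle_through f s"
    have Z: "?Z \<in> f_cycles S f" using True by (rule cycle_through_mem)
    have "x ?Z \<in> orbit f s" using x[OF Z] by simp
    then have "s \<in> orbit f (x ?Z)" using orbit_eq_iff in_orbit_self by metis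
    then obtain n where "s = (f ^^ n) (x ?Z)" by (rule orbit_funpowE)
    then show ?thesis
      using g g' eq[OF Z]
      by (metis (mono_tags, lifting) commuting_permutations_def funpow_commuting mem_Collect_eq)
  next
    case False
    then show ?thesis using g g' by (auto simp: commuting_permutations_def permutes_not_in)
  qed
qed

end

theorem theorem2p3:
  fixes S X :: "'a set" and f :: "'a \<Rightarrow> 'a" and x :: "'a pair_pre_digraph \<Rightarrow> 'a"
  assumes "finite S"
    and "f permutes S"
    and "\<And>Z. Z \<in> f_cycles S f \<Longrightarrow> x Z \<in> pverts Z"
    and "X = x ` f_cycles S f"
  shows "bij_betw (\<lambda>g. (induced_cycle_map S f g, restrict g X))
           (commuting_permutations S f)
           {(\<pi>, h).
              \<pi> permutes f_cycles S f \<and>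
              (\<forall>i. \<pi> ` f_cycles_of_length S f i = f_cycles_of_length S f i) \<and>
              h \<in> X \<rightarrow>\<^sub>E S \<and>
              (\<forall>Z\<in>f_cycles S f. h (x Z) \<in> pverts (\<pi> Z))}"
    (is "bij_betw ?\<Phi> ?C ?P")
proof -
  interpret finite_permutation S f
    using assms(1,2) by unfold_locales
  note x = assms(3) and X = assms(4)
  have inj: "inj_on ?\<Phi> ?C"
  proof (rule inj_onI)
    fix g g' assume g: "g \<in> ?C" "g' \<in> ?C" and "?\<Phi> g = ?\<Phi> g'"
    then have "restrict g X = restrict g' X" by simp
    then have "g (x Z) = g' (x Z)" if "Z \<in> f_cycles S f" for Z
      using that X by (metis imageI restrict_apply')
    then show "g = g'" using x g commuting_permutations_eqI by blast
  qed
  have into: "?\<Phi> g \<in> ?P" if g: "g \<in> ?C" for g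
  proof -
    have "X \<subseteq> S" using x X pverts_f_cycle_subset by blast
    moreover have "g permutes S" using g by (simp add: commuting_permutations_def)
    ultimately have "restrict g X \<in> X \<rightarrow>\<^sub>E S" by (auto simp: permutes_in_image)
    moreover have "restrict g X (x Z) \<in> pverts (induced_cycle_map S f g Z)"
      if "Z \<in> f_cycles S f" for Z
      using that x X pverts_induced_cycle_map[OF g] by auto
    ultimately show ?thesis
      using induced_cycle_map_permutes[OF g] induced_cycle_map_image_length[OF g] by simp
  qed
  have onto: "p \<in> ?\<Phi> ` ?C" if p: "p \<in> ?P" for p
  proof -
    obtain \<pi> h where p_eq: "p = (\<pi>, h)" by fastforce
    have \<pi>: "\<pi> permutes f_cycles S f"
      and len: "\<And>i. \<pi> ` f_cycles_of_length S f i = f_cycles_of_length S f i"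
      and h_ext: "h \<in> X \<rightarrow>\<^sub>E S"
      and h: "\<And>Z. Z \<in> f_cycles S f \<Longrightarrow> h (x Z) \<in> pverts (\<pi> Z)"
      using p p_eq by auto
    obtain g where g: "g \<in> ?C" and gx: "\<And>Z. Z \<in> f_cycles S f \<Longrightarrow> g (x Z) = h (x Z)"
      using commuting_permutation_extension[of x \<pi> h, OF x \<pi> len h] by blast
    have "induced_cycle_map S f g = \<pi>"
    proof (rule ext)
      fix Z
      show "induced_cycle_map S f g Z = \<pi> Z"
      proof (cases "Z \<in> f_cycles S f")
        case True
        then have "induced_cycle_map S f g Z \<in> f_cycles S f" "\<pi> Z \<in> f_cycles S f"
          using \<pi> induced_cycle_map_permutes[OF g] by (simp_all add: permutes_in_image)
        moreover have "h (x Z) \<in> pverts (induced_cycle_map S f g Z)"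
          using pverts_induced_cycle_map[OF g True] x[OF True] gx[OF True] by (metis imageI)
        ultimately show ?thesis
          using h[OF True] f_cycle_eq_cycle_through by metis
      next
        case False
        then show ?thesis using \<pi> by (simp add: induced_cycle_map_def permutes_not_in)
      qed
    qed
    moreover have "restrict g X = h"
    proof (rule extensionalityI[of _ X])
      show "h \<in> extensional X" using h_ext by (simp add: PiE_def)
      show "restrict g X y = h y" if "y \<in> X" for y
        using that gx unfolding X by force
    qed (rule restrict_extensional)
    ultimately have "p = ?\<Phi> g" unfolding p_eq by simp
    then show ?thesis using g by blast
  qed
  have "?\<Phi> ` ?C = ?P"
    by (intro equalityI image_subsetI subsetI into onto)
  with inj show ?thesis by (rule bij_betw_imageI)
qed

end
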